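(* Let $\mathcal{H}$ be an infinite-dimensional separable real Hilbert space, let $(e_k)_{k\in\mathbb{N}}$ (with $\mathbb{N}=\{0,1,2,\dots\}$) be an orthonormal basis of $\mathcal{H}$, let $V=\{e_0\}^\perp$, and let $K$ be the smallest closed convex cone containing the set $$\Big\{\exp(-100\xi^3)\,e_0+\cos\big(\pi(\xi-\lfloor\xi\rfloor)/2\big)\,e_{\lfloor\xi\rfloor+1}+\sin\big(\pi(\xi-\lfloor\xi\rfloor)/2\big)\,e_{\lfloor\xi\rfloor+2}\ \Big|\ \xi\in[0,+\infty[\Big\}.$$ Let $\mathrm{proj}_V$ and $\mathrm{proj}_K$ be the projection operators onto $V$ and $K$. Define the set-valued operators $A,B\colon\mathcal{H}\to 2^{\mathcal{H}}$ by $$Ax=\begin{cases}V^\perp,&\text{if }x\in V;\\ \varnothing,&\text{if }x\notin V\end{cases}\qquad\text{and}\qquad B=\big(\mathrm{proj}_V\circ\mathrm{proj}_K\circ\mathrm{proj}_V\big)^{-1}-\mathrm{Id}.$$ Then $A$ and $B$ are maximally monotone. Moreover, let $y_0=e_2$ and let $(x_n)_{n\in\mathbb{N}}$ and $(y_n)_{n\in\mathbb{N}}$ be the sequences generated by the Douglas--Rachford iteration $$(\forall n\in\mathbb{N})\quad x_n=J_By_n\quad\text{and}\quad y_{n+1}=y_n+J_A(2x_n-y_n)-x_n.$$ Then $(x_n)_{n\in\mathbb{N}}$ converges weakly but not strongly to a zero of $A+B$, that is, to a point $x\in\mathcal{H}$ such that $0\in Ax+Bx$.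
   Context: For a set-valued operator $M\colon\mathcal{H}\to 2^{\mathcal{H}}$, the inverse $M^{-1}$ is the set-valued operator defined by $x\in M^{-1}u\Leftrightarrow u\in Mx$; a single-valued map $T\colon\mathcal{H}\to\mathcal{H}$ is identified with the set-valued operator $x\mapsto\{Tx\}$. Thus, for $T=\mathrm{proj}_V\circ\mathrm{proj}_K\circ\mathrm{proj}_V$ and $B=T^{-1}-\mathrm{Id}$, $Bx=\{u-x\mid u\in\mathcal{H},\ Tu=x\}$ for every $x\in\mathcal{H}$. $M$ is monotone if $\langle x-y\mid u-v\rangle\geq 0$ whenever $u\in Mx$ and $v\in My$, and maximally monotone if it is monotone and its graph is not properly contained in the graph of another monotone operator. The resolvent of $M$ is $J_M=(\mathrm{Id}+M)^{-1}$; if $M$ is maximally monotone, $J_M$ is single-valued and defined on all of $\mathcal{H}$. For a nonempty closed convex set $C\subset\mathcal{H}$, $\mathrm{proj}_C$ maps each point to its unique nearest point in $C$. $\lfloor\xi\rfloor$ denotes the integer part (floor) of $\xi$. *)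

theory Defs
  imports "HOL-Analysis.Analysis"
begin

definition infinite_dimensional :: "'a::real_vector itself \<Rightarrow> bool" where
  "infinite_dimensional _ \<longleftrightarrow> \<not> (\<exists>S::'a set. finite S \<and> span S = UNIV)"

definition orthonormal_basis :: "(nat \<Rightarrow> 'a::real_inner) \<Rightarrow> bool" where
  "orthonormal_basis e \<longleftrightarrow>
     (\<forall>i j. e i \<bullet> e j = (if i = j then 1 else 0)) \<and> closure (span (range e)) = UNIV"

definition weakly_converges :: "(nat \<Rightarrow> 'a::real_inner) \<Rightarrow> 'a \<Rightarrow> bool" where
  "weakly_converges x l \<longleftrightarrow> (\<forall>u. (\<lambda>n. x n \<bullet> u) \<longlonglongrightarrow> l \<bullet> u)"

text \<open>The library's \<^const>\<open>closest_point\<close> is restricted to the class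
  \<^class>\<open>heine_borel\<close>, hence to finite dimension.\<close>

definition proj :: "'a::metric_space set \<Rightarrow> 'a \<Rightarrow> 'a" where
  "proj C x = (THE p. p \<in> C \<and> (\<forall>q\<in>C. dist x p \<le> dist x q))"

text \<open>The library's \<^const>\<open>cone\<close> is closed under multiplication by all \<open>c \<ge> 0\<close>. Requiring only
  \<open>c > 0\<close> would give the same closed convex cone, since a nonempty closed set
  closed under positive scaling contains 0.\<close>

definition closed_convex_cone_hull :: "'a::real_normed_vector set \<Rightarrow> 'a set" where
  "closed_convex_cone_hull S = (\<lambda>C. closed C \<and> convex C \<and> cone C) hull S"

type_synonym 'a operator = "'a \<Rightarrow> 'a set"

definition op_of_fun :: "('a \<Rightarrow> 'a) \<Rightarrow> 'a operator" where
  "op_of_fun T = (\<lambda>x. {T x})"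

definition op_graph :: "'a operator \<Rightarrow> ('a \<times> 'a) set" where
  "op_graph M = {(x, u). u \<in> M x}"

definition op_inverse :: "'a operator \<Rightarrow> 'a operator" where
  "op_inverse M = (\<lambda>u. {x. u \<in> M x})"

definition op_add :: "'a::plus operator \<Rightarrow> 'a operator \<Rightarrow> 'a operator" where
  "op_add M N = (\<lambda>x. {u + v |u v. u \<in> M x \<and> v \<in> N x})"

definition op_diff :: "'a::minus operator \<Rightarrow> 'a operator \<Rightarrow> 'a operator" where
  "op_diff M N = (\<lambda>x. {u - v |u v. u \<in> M x \<and> v \<in> N x})"

definition monotone_op :: "'a::real_inner operator \<Rightarrow> bool" where
  "monotone_op M \<longleftrightarrow> (\<forall>x y u v. u \<in> M x \<longrightarrow> v \<in> M y \<longrightarrow> (x - y) \<bullet> (u - v) \<ge> 0)"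

definition maximally_monotone :: "'a::real_inner operator \<Rightarrow> bool" where
  "maximally_monotone M \<longleftrightarrow>
     monotone_op M \<and> \<not> (\<exists>N. monotone_op N \<and> op_graph M \<subset> op_graph N)"

definition resolvent :: "'a::plus operator \<Rightarrow> 'a operator" where
  "resolvent M = op_inverse (op_add (op_of_fun id) M)"

text \<open>The resolvent read as a map, meaningful when every value of \<^const>\<open>resolvent\<close> is a singleton,
  in particular when \<open>M\<close> is maximally monotone on a Hilbert space.\<close>

definition resolvent_map :: "'a::plus operator \<Rightarrow> 'a \<Rightarrow> 'a" where
  "resolvent_map M x = the_elem (resolvent M x)"

end

theory Submission
  imports Defs
begin

text \<open>With \<open>T = proj V \<circ> proj K \<circ> proj V\<close>, which is firmly nonexpansive, the resolvents of \<open>B\<close> and \<open>A\<close> are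
  \<open>T\<close> and \<open>proj V\<close>, so the iteration started in \<open>V\<close> is the method of alternating projections
  \<open>y (Suc n) = proj V (proj K (y n))\<close> of Hundal's counterexample.

  Let \<open>z n \<in> K\<close> be the points with \<open>y n = proj V (z n)\<close>, let \<open>\<phi> n\<close> be the \<open>e 0\<close>-coordinate of \<open>z n\<close> and
  let \<open>g \<xi>\<close> be the component in \<open>V\<close> of the generator at \<open>\<xi>\<close>, whose height is \<open>h \<xi> = exp (- 100 * \<xi> ^ 3)\<close>.
  As \<open>K\<close> is a cone, \<open>norm (y n)\<^sup>2\<close> drops by at least \<open>2 * \<phi> (n + 1)\<^sup>2\<close> in each step, hence \<open>\<phi> n\<close> tends to \<open>0\<close>;
  every coordinate of a point of \<open>K\<close> is controlled by its height, so \<open>y n\<close> converges weakly to \<open>0\<close>.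

  For the failure of strong convergence, follow \<open>y n \<bullet> g (\<xi> n)\<close> where \<open>h (\<xi> n) = \<phi> n\<close>. Polarity of \<open>K\<close> bounds
  its loss in one projection by \<open>\<phi> n * \<phi> (n + 1)\<close>, and these losses sum to about half at most. Rotating
  \<open>g \<xi>\<close> forward costs little: a point of \<open>K\<close> of norm at most 1 and height at most \<open>h \<xi>\<close> has almost no mass on generators
  before \<open>\<xi> - \<eta>\<close> with \<open>\<eta>\<close> of order \<open>\<xi> powr (- 3 / 2)\<close>, so the inner product decreases at a rate of order \<open>\<eta>\<close>,
  which is integrable with a small integral.\<close>

section \<open>Projections in Hilbert space\<close>

text \<open>A minimizing sequence is Cauchy: the midpoint of two of its members lies in
  \<open>C\<close>, hence at distance at least \<open>d\<close> from \<open>x\<close>, and the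
  parallelogram identity bounds their distance.\<close>

lemma nearest_point_exists:
  fixes C :: "'a::{real_inner, complete_space} set"
  assumes "closed C" "convex C" "C \<noteq> {}"
  shows "\<exists>p\<in>C. \<forall>q\<in>C. dist x p \<le> dist x q"
proof -
  define d where "d = infdist x C"
  have d_le: "d \<le> dist x q" if "q \<in> C" for q
    using that by (simp add: d_def infdist_le)
  have d0: "0 \<le> d" by (simp add: d_def infdist_nonneg)
  have "\<exists>q\<in>C. dist x q < d + inverse (real (Suc n))" for n
  proof -
    have "(INF q\<in>C. dist x q) < d + inverse (real (Suc n))"
      using assms by (simp add: d_def infdist_notempty)
    then show ?thesis
      using assms cINF_less_iff[of C "dist x"] by (metis bdd_below_image_dist)
  qed
  then obtain q where q: "\<And>n. q n \<in> C" "\<And>n. dist x (q n) < d + inverse (real (Suc n))"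
    by metis
  have close: "(dist (q m) (q n))\<^sup>2 \<le> 8 * d * inverse (real (Suc N)) + 4 * (inverse (real (Suc N)))\<^sup>2"
    if "m \<ge> N" "n \<ge> N" for m n N
  proof -
    let ?r = "inverse (real (Suc N))"
    have le: "dist x (q i) \<le> d + ?r" if "i \<ge> N" for i
    proof -
      have "inverse (real (Suc i)) \<le> ?r" using that by (intro le_imp_inverse_le) auto
      then show ?thesis using q(2)[of i] by linarith
    qed
    have "(1/2) *\<^sub>R q m + (1/2) *\<^sub>R q n \<in> C"
      using assms(2) q(1) by (intro convexD) auto
    then have "d\<^sup>2 \<le> (dist x ((1/2) *\<^sub>R q m + (1/2) *\<^sub>R q n))\<^sup>2"
      using d_le d0 by (intro power_mono) auto
    also have "\<dots> = (dist x (q m))\<^sup>2 / 2 + (dist x (q n))\<^sup>2 / 2 - (dist (q m) (q n))\<^sup>2 / 4"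
      by (simp add: dist_norm power2_norm_eq_inner inner_diff_left inner_diff_right
          inner_add_left inner_add_right inner_commute field_simps)
    finally have "(dist (q m) (q n))\<^sup>2 \<le> 2 * (dist x (q m))\<^sup>2 + 2 * (dist x (q n))\<^sup>2 - 4 * d\<^sup>2"
      by simp
    also have "\<dots> \<le> 2 * (d + ?r)\<^sup>2 + 2 * (d + ?r)\<^sup>2 - 4 * d\<^sup>2"
      using le[OF that(1)] le[OF that(2)] by (intro diff_right_mono add_mono mult_left_mono power_mono) auto
    also have "\<dots> = 8 * d * ?r + 4 * ?r\<^sup>2"
      by (simp add: power2_eq_square algebra_simps)
    finally show ?thesis .
  qed
  have "Cauchy q"
  proof (rule metric_CauchyI)
    fix \<epsilon> :: real assume "\<epsilon> > 0"
    have "(\<lambda>N. 8 * d * inverse (real (Suc N)) + 4 * (inverse (real (Suc N)))\<^sup>2) \<longlonglongrightarrow> 8 * d * 0 + 4 * 0\<^sup>2"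
      by (intro tendsto_intros LIMSEQ_inverse_real_of_nat)
    then have "\<forall>\<^sub>F N in sequentially.
        8 * d * inverse (real (Suc N)) + 4 * (inverse (real (Suc N)))\<^sup>2 < \<epsilon>\<^sup>2"
      using \<open>\<epsilon> > 0\<close> by (intro order_tendstoD(2)) auto
    from eventually_happens'[OF sequentially_bot this]
    obtain N where N: "8 * d * inverse (real (Suc N)) + 4 * (inverse (real (Suc N)))\<^sup>2 < \<epsilon>\<^sup>2" ..
    have "dist (q m) (q n) < \<epsilon>" if "m \<ge> N" "n \<ge> N" for m n
    proof (rule power_less_imp_less_base)
      show "(dist (q m) (q n))\<^sup>2 < \<epsilon>\<^sup>2" using close[OF that] N by (rule le_less_trans)
    qed (use \<open>\<epsilon> > 0\<close> in simp)
    then show "\<exists>N. \<forall>m\<ge>N. \<forall>n\<ge>N. dist (q m) (q n) < \<epsilon>" by blast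
  qed
  then obtain p where p: "q \<longlonglongrightarrow> p"
    using Cauchy_convergent convergent_def by blast
  have "p \<in> C" using assms(1) q(1) p closed_sequentially by blast
  moreover have "dist x p \<le> d"
  proof (rule LIMSEQ_le)
    show "(\<lambda>n. dist x (q n)) \<longlonglongrightarrow> dist x p" by (intro tendsto_intros p)
    show "(\<lambda>n. d + inverse (real (Suc n))) \<longlonglongrightarrow> d"
      using LIMSEQ_inverse_real_of_nat_add by simp
    show "\<exists>N. \<forall>n\<ge>N. dist x (q n) \<le> d + inverse (real (Suc n))"
      using q(2) less_imp_le by blast
  qed
  ultimately show ?thesis using d_le by force
qed

lemma proj_nearest:
  fixes C :: "'a::{real_inner, complete_space} set"
  assumes "closed C" "convex C" "C \<noteq> {}"
  shows "proj C x \<in> C \<and> (\<forall>q\<in>C. dist x (proj C x) \<le> dist x q)"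
  unfolding proj_def
proof (rule theI')
  show "\<exists>!p. p \<in> C \<and> (\<forall>q\<in>C. dist x p \<le> dist x q)"
    using nearest_point_exists[OF assms] any_closest_point_unique[OF assms(2,1)] by blast
qed

lemma proj_inner_le:
  fixes C :: "'a::{real_inner, complete_space} set"
  assumes "closed C" "convex C" "q \<in> C"
  shows "(x - proj C x) \<bullet> (q - proj C x) \<le> 0"
  using proj_nearest[of C x] any_closest_point_dot[of C "proj C x" q x] assms by blast

lemma proj_firmly_nonexpansive:
  fixes C :: "'a::{real_inner, complete_space} set"
  assumes "closed C" "convex C" "C \<noteq> {}"
  shows "(norm (proj C x - proj C y))\<^sup>2 \<le> (proj C x - proj C y) \<bullet> (x - y)"
proof -
  have "(x - proj C x) \<bullet> (proj C y - proj C x) \<le> 0" "(y - proj C y) \<bullet> (proj C x - proj C y) \<le> 0"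
    using proj_nearest[OF assms] proj_inner_le assms by blast+
  then show ?thesis
    by (simp add: power2_norm_eq_inner inner_diff_left inner_diff_right inner_commute)
qed

text \<open>The obtuse angle at \<open>p\<close> gives \<open>(dist x p)\<^sup>2 + (dist p
  q)\<^sup>2 \<le> (dist x q)\<^sup>2\<close>, from which minimality and uniqueness both
  follow.\<close>

lemma proj_eqI:
  fixes C :: "'a::real_inner set"
  assumes "p \<in> C" "\<And>q. q \<in> C \<Longrightarrow> (x - p) \<bullet> (q - p) \<le> 0"
  shows "proj C x = p"
proof -
  have key: "(dist x p)\<^sup>2 + (dist p q)\<^sup>2 \<le> (dist x q)\<^sup>2" if "q \<in> C" for q
    using assms(2)[OF that]
    by (simp add: dist_norm power2_norm_eq_inner inner_diff_left inner_diff_right inner_commute)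
  show ?thesis unfolding proj_def
  proof (rule the_equality)
    have "dist x p \<le> dist x q" if "q \<in> C" for q
      using key[OF that] zero_le_power2[of "dist p q"] by (meson power2_le_imp_le zero_le_dist le_add_same_cancel1 order_trans)
    then show "p \<in> C \<and> (\<forall>q\<in>C. dist x p \<le> dist x q)" using assms by blast
  next
    fix r assume r: "r \<in> C \<and> (\<forall>q\<in>C. dist x r \<le> dist x q)"
    then have "dist x r \<le> dist x p" using assms(1) by blast
    then have "(dist x r)\<^sup>2 \<le> (dist x p)\<^sup>2" by (intro power_mono) auto
    then have "(dist p r)\<^sup>2 \<le> 0" using key[of r] r by linarith
    then show "r = p" by simp
  qed
qed

text \<open>The residual is orthogonal to the projection and lies in the polar cone: test the
  variational inequality at twice the projection and at 0.\<close>

lemma proj_cone_inner: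
  fixes C :: "'a::{real_inner, complete_space} set"
  assumes "closed C" "convex C" "cone C" "C \<noteq> {}"
  shows "(x - proj C x) \<bullet> proj C x = 0"
    and "k \<in> C \<Longrightarrow> (x - proj C x) \<bullet> k \<le> 0"
proof -
  let ?p = "proj C x"
  have p: "?p \<in> C" using proj_nearest assms by blast
  have "c *\<^sub>R ?p \<in> C" if "c \<ge> 0" for c using assms(3) p that by (simp add: cone_def)
  from this[of 2] this[of 0] show *: "(x - ?p) \<bullet> ?p = 0"
    using proj_inner_le[OF assms(1,2), of "2 *\<^sub>R ?p" x] proj_inner_le[OF assms(1,2), of "0 *\<^sub>R ?p" x]
    by (simp add: inner_diff_right)
  show "(x - ?p) \<bullet> k \<le> 0" if "k \<in> C"
    using proj_inner_le[OF assms(1,2) that, of x] * by (simp add: inner_diff_right)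
qed

section \<open>Resolvents\<close>

lemma mem_op_inverse_diff_id:
  "w \<in> op_diff (op_inverse (op_of_fun T)) (op_of_fun id) x \<longleftrightarrow> T (x + w) = (x::'a::ab_group_add)"
proof
  assume "w \<in> op_diff (op_inverse (op_of_fun T)) (op_of_fun id) x"
  then show "T (x + w) = x" by (auto simp: op_diff_def op_inverse_def op_of_fun_def)
next
  assume "T (x + w) = x"
  then have "w = (x + w) - x \<and> x + w \<in> op_inverse (op_of_fun T) x \<and> x \<in> op_of_fun id x"
    by (simp add: op_inverse_def op_of_fun_def)
  then show "w \<in> op_diff (op_inverse (op_of_fun T)) (op_of_fun id) x"
    unfolding op_diff_def by blast
qed

lemma mem_resolvent: "x \<in> resolvent M y \<longleftrightarrow> y - x \<in> M (x::'a::ab_group_add)"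
  by (auto simp: resolvent_def op_inverse_def op_add_def op_of_fun_def algebra_simps)
    (metis add.commute diff_add_cancel)

text \<open>Adding the identity back to the operator leaves the inverse of \<open>T\<close>, so the
  resolvent is \<open>T\<close> itself, single-valued for every map \<open>T\<close>.\<close>

lemma resolvent_map_op_inverse_diff_id:
  "resolvent_map (op_diff (op_inverse (op_of_fun T)) (op_of_fun id)) y = (T y :: 'a::ab_group_add)"
proof -
  have "resolvent (op_diff (op_inverse (op_of_fun T)) (op_of_fun id)) y = {T y}"
    by (auto simp: mem_resolvent mem_op_inverse_diff_id)
  then show ?thesis by (simp add: resolvent_map_def)
qed

text \<open>The graph consists of the pairs \<open>(T u, u - T u)\<close>. If \<open>(x, w)\<close>
  belongs to a monotone extension, comparing it with the pair for \<open>u = x + w\<close> forces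
  \<open>x = T u\<close>, so it was already in the graph.\<close>

lemma maximally_monotone_firmly_nonexpansive:
  fixes T :: "'a::real_inner \<Rightarrow> 'a"
  assumes T: "\<And>u v. (norm (T u - T v))\<^sup>2 \<le> (T u - T v) \<bullet> (u - v)"
  shows "maximally_monotone (op_diff (op_inverse (op_of_fun T)) (op_of_fun id))"
    (is "maximally_monotone ?B")
  unfolding maximally_monotone_def
proof (intro conjI notI)
  show "monotone_op ?B"
    unfolding monotone_op_def mem_op_inverse_diff_id
  proof (intro allI impI)
    fix x y u v assume "T (x + u) = x" "T (y + v) = y"
    then show "0 \<le> (x - y) \<bullet> (u - v)"
      using T[of "x + u" "y + v"]
      by (simp add: power2_norm_eq_inner inner_diff_left inner_diff_right inner_add_right)
  qed
next
  assume "\<exists>N. monotone_op N \<and> op_graph ?B \<subset> op_graph N"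
  then obtain N x w where N: "monotone_op N" "op_graph ?B \<subseteq> op_graph N"
    and xw: "w \<in> N x" "w \<notin> ?B x"
    by (auto simp: op_graph_def)
  let ?u = "x + w"
  have "?u - T ?u \<in> ?B (T ?u)" by (simp add: mem_op_inverse_diff_id)
  then have "?u - T ?u \<in> N (T ?u)" using N(2) by (auto simp: op_graph_def)
  then have "0 \<le> (x - T ?u) \<bullet> (w - (?u - T ?u))"
    using N(1) xw(1) unfolding monotone_op_def by blast
  also have "\<dots> = - ((x - T ?u) \<bullet> (x - T ?u))"
    by (simp add: inner_diff_right)
  finally have "(x - T ?u) \<bullet> (x - T ?u) = 0"
    using inner_ge_zero[of "x - T ?u"] by linarith
  then have "x = T ?u" by simp
  then show False using xw(2) by (simp add: mem_op_inverse_diff_id)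
qed

text \<open>Split an extra pair \<open>(x, u)\<close> along \<open>V\<close>. One test pair
  eliminates the part of \<open>x\<close> orthogonal to \<open>V\<close>, a second one the part of
  \<open>u\<close> in \<open>V\<close>.\<close>

lemma maximally_monotone_normal_cone:
  fixes V :: "'a::real_inner set"
  assumes V: "subspace V" and split: "\<And>x. \<exists>v\<in>V. x - v \<in> V\<^sup>\<bottom>"
  shows "maximally_monotone (\<lambda>x. if x \<in> V then V\<^sup>\<bottom> else {})" (is "maximally_monotone ?A")
  unfolding maximally_monotone_def
proof (intro conjI notI)
  have orth: "v \<bullet> w = 0" if "v \<in> V" "w \<in> V\<^sup>\<bottom>" for v w
    using that by (simp add: orthogonal_comp_def orthogonal_def)
  show "monotone_op ?A"
    unfolding monotone_op_def
    by (auto simp: orth V subspace_diff subspace_orthogonal_comp split: if_splits)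
  assume "\<exists>N. monotone_op N \<and> op_graph ?A \<subset> op_graph N"
  then obtain N x u where N: "monotone_op N" "op_graph ?A \<subseteq> op_graph N"
    and xu: "u \<in> N x" "(x, u) \<notin> op_graph ?A"
    by (auto simp: op_graph_def)
  have mono: "0 \<le> (x - v) \<bullet> (u - w)" if "v \<in> V" "w \<in> V\<^sup>\<bottom>" for v w
  proof -
    have "(v, w) \<in> op_graph ?A" using that by (simp add: op_graph_def)
    then have "w \<in> N v" using N(2) by (auto simp: op_graph_def)
    then show ?thesis using N(1) xu(1) unfolding monotone_op_def by blast
  qed
  obtain x' where x': "x' \<in> V" "x - x' \<in> V\<^sup>\<bottom>" using split by blast
  obtain u' where u': "u' \<in> V" "u - u' \<in> V\<^sup>\<bottom>" using split by blast
  have "(u - u') + (x - x') \<in> V\<^sup>\<bottom>"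
    using x' u' subspace_orthogonal_comp subspace_add by blast
  from mono[OF x'(1) this] have "0 \<le> (x - x') \<bullet> (u' - (x - x'))"
    by (simp add: algebra_simps)
  moreover have "0 \<le> (x - x') \<bullet> (x - x')" by simp
  ultimately have "(x - x') \<bullet> (x - x') = 0"
    using orth[OF u'(1) x'(2)] by (simp add: inner_diff_right[of "x - x'" u'] inner_commute[of _ u'])
  then have "x = x'" by simp
  have "x' + u' \<in> V" using x' u' V subspace_add by blast
  from mono[OF this u'(2)] \<open>x = x'\<close> have "u' \<bullet> u' \<le> 0" by simp
  then have "u' = 0" by (metis inner_gt_zero_iff not_less)
  then have "(x, u) \<in> op_graph ?A" using x' u' \<open>x = x'\<close> by (simp add: op_graph_def)
  then show False using xu by blast
qed

text \<open>Points of \<open>V\<close> suffice: the iteration starts in \<open>V\<close> and never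
  leaves it.\<close>

lemma resolvent_map_normal_cone:
  fixes V :: "'a::real_inner set"
  assumes "subspace V" "y \<in> V"
  shows "resolvent_map (\<lambda>x. if x \<in> V then V\<^sup>\<bottom> else {}) y = y"
proof -
  have "x = y" if "x \<in> V" "y - x \<in> V\<^sup>\<bottom>" for x
  proof -
    have "y - x \<in> V" using assms that subspace_diff by blast
    then have "(y - x) \<bullet> (y - x) = 0"
      using that by (simp add: orthogonal_comp_def orthogonal_def)
    then show ?thesis by simp
  qed
  then have "resolvent (\<lambda>x. if x \<in> V then V\<^sup>\<bottom> else {}) y = {y}"
    using assms subspace_0[OF subspace_orthogonal_comp[of V]]
    by (auto simp: mem_resolvent split: if_splits)
  then show ?thesis by (simp add: resolvent_map_def)
qed

section \<open>Estimates along the generating curve\<close>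

text \<open>The lag \<open>\<eta>\<close> is of order \<open>t powr (- 3 / 2)\<close>, small enough
  to be integrable, while the gap between the exponents, of order \<open>t\<^sup>2 * \<eta>\<close>,
  still grows like \<open>sqrt t\<close>.\<close>

lemma height_ratio_le:
  fixes t :: real
  assumes t: "t \<ge> 1"
  defines "\<eta> \<equiv> 1 / (20 * (t * sqrt t))"
  shows "exp (- 100 * t ^ 3) * exp (100 * (t - \<eta>) ^ 3) \<le> 1 / (100 * (t * sqrt t))"
proof -
  define r where "r = sqrt t"
  have r: "r \<ge> 1" "t = r\<^sup>2" using t by (auto simp: r_def)
  have \<eta>: "\<eta> = 1 / (20 * r ^ 3)"
    using r by (simp add: \<eta>_def r_def[symmetric] power2_eq_square power3_eq_cube)
  have r3: "r ^ 3 \<ge> 1" "r\<^sup>2 \<ge> 1" using r by auto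
  have \<eta>_le: "0 < \<eta>" "\<eta> \<le> 1 / 20" using r(1) r3 by (auto simp: \<eta> divide_simps)
  \<comment> \<open>The gap is at least \<open>300 * t * \<eta> * (t - \<eta>)\<close>, where
    \<open>300 * t * \<eta> = 15 / r\<close> and \<open>15 * 19 / 20\<close> exceeds 14.\<close>
  have "14 * r \<le> 300 * (1 / (20 * r)) * (19 / 20 * r\<^sup>2)"
    using r by (simp add: power2_eq_square field_simps)
  also have "\<dots> \<le> 300 * (1 / (20 * r)) * (t - \<eta>)"
  proof (rule mult_left_mono)
    show "19 / 20 * r\<^sup>2 \<le> t - \<eta>" using r(2) r3 \<eta>_le by linarith
  qed (use r(1) in simp)
  also have "1 / (20 * r) = t * \<eta>"
    using r by (simp add: \<eta> power2_eq_square power3_eq_cube)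
  also have "300 * (t * \<eta>) * (t - \<eta>) \<le> 100 * t ^ 3 - 100 * (t - \<eta>) ^ 3"
  proof -
    have "100 * t ^ 3 - 100 * (t - \<eta>) ^ 3 = 300 * (t * \<eta>) * (t - \<eta>) + 100 * \<eta> ^ 3"
      by (simp add: power3_eq_cube algebra_simps)
    then show ?thesis using \<eta>_le by simp
  qed
  finally have "- 100 * t ^ 3 + 100 * (t - \<eta>) ^ 3 \<le> - (14 * r)" by linarith
  then have "exp (- 100 * t ^ 3) * exp (100 * (t - \<eta>) ^ 3) \<le> exp (- (14 * r))"
    unfolding exp_add[symmetric] by simp
  also have "\<dots> \<le> 1 / (100 * r ^ 3)"
  proof -
    \<comment> \<open>The cube of \<open>14 / 3\<close> is about 101.6.\<close>
    have "100 * r ^ 3 \<le> (14 / 3 * r) ^ 3" using r by (simp add: power_mult_distrib power3_eq_cube)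
    also have "\<dots> \<le> exp (14 / 3 * r) ^ 3"
    proof (rule power_mono)
      show "14 / 3 * r \<le> exp (14 / 3 * r)" using exp_ge_add_one_self[of "14 / 3 * r"] by linarith
    qed (use r in simp)
    also have "\<dots> = exp (14 * r)" by (simp flip: exp_of_nat_mult)
    finally show ?thesis
      using r by (simp add: exp_minus field_simps)
  qed
  finally show ?thesis using r by (simp add: r_def[symmetric] power2_eq_square power3_eq_cube)
qed

text \<open>To first order the claim is \<open>(pi / 2)\<^sup>2 < 3\<close>; the bound on
  \<open>\<eta>\<close> keeps \<open>cos \<tau>\<close> above \<open>9 / 10\<close>, which leaves
  enough room.\<close>

lemma small_angle_le:
  assumes "0 \<le> \<tau>" "\<tau> \<le> pi * \<eta> / 2" "\<eta> \<le> 1 / 20"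
  shows "pi / 2 * sin \<tau> \<le> 3 * \<eta> * cos \<tau>"
proof -
  have pi: "pi \<le> 3.15" using pi_approx by simp
  have \<eta>0: "0 \<le> \<eta>" using assms pi_gt_zero by (smt (verit) mult_pos_neg divide_neg_pos)
  have "pi * \<eta> \<le> 3.15 * (1 / 20)" using pi assms \<eta>0 by (intro mult_mono) auto
  then have \<tau>: "\<tau> \<le> 1 / 10" using assms by simp
  have "pi / 2 * sin \<tau> \<le> 3.15 / 2 * \<tau>"
    using pi assms(1) sin_x_le_x[OF assms(1)] \<tau> pi_gt3 by (intro mult_mono sin_ge_zero) auto
  also have "\<dots> \<le> 3.15 / 2 * (3.15 * \<eta> / 2)"
    using assms pi \<eta>0 mult_right_mono[OF pi \<eta>0] by simp
  also have "\<dots> \<le> 3 * \<eta> * (9 / 10)" using \<eta>0 by simp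
  also have "\<dots> \<le> 3 * \<eta> * cos \<tau>"
  proof -
    have "9 / 10 \<le> cos \<tau>"
    proof -
      have sq: "\<tau>\<^sup>2 \<le> (1 / 10)\<^sup>2" using \<tau> assms(1) by (intro power_mono) auto
      have "0 \<le> cos \<tau>" using \<tau> assms(1) pi_gt3 by (intro cos_ge_zero) auto
      then have "(cos \<tau>)\<^sup>2 \<le> cos \<tau>" by (simp add: power2_eq_square mult_left_le)
      moreover have "(sin \<tau>)\<^sup>2 \<le> \<tau>\<^sup>2"
        using \<tau> assms(1) sin_x_le_x pi_gt3 by (intro power_mono sin_ge_zero) auto
      moreover have "(sin \<tau>)\<^sup>2 + (cos \<tau>)\<^sup>2 = 1" by simp
      moreover have "(1 / 10 :: real)\<^sup>2 \<le> 1 / 10" by (simp add: power2_eq_square)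
      ultimately show ?thesis using sq by linarith
    qed
    then show ?thesis using \<eta>0 by (intro mult_left_mono) auto
  qed
  finally show ?thesis .
qed


section \<open>Hundal's cone\<close>

locale total_orthonormal =
  fixes e :: "nat \<Rightarrow> 'a::{real_inner, complete_space}"
  assumes basis: "orthonormal_basis e"
begin

lemma inner_basis [simp]: "e i \<bullet> e j = (if i = j then 1 else 0)"
  using basis by (simp add: orthonormal_basis_def)

text \<open>Linearity extends the coordinatewise limits to the span, and boundedness extends them to
  its closure.\<close>

lemma weakly_converges_0I:
  assumes bounded: "\<And>n. norm (x n) \<le> b" and coord: "\<And>i. (\<lambda>n. x n \<bullet> e i) \<longlonglongrightarrow> 0"
  shows "weakly_converges x 0"
  unfolding weakly_converges_def
proof
  fix u
  let ?S = "{u. (\<lambda>n. x n \<bullet> u) \<longlonglongrightarrow> 0}"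
  have "subspace ?S"
    by (rule subspaceI)
      (auto simp: inner_add_right intro: tendsto_add_zero tendsto_mult_right_zero)
  then have span: "span (range e) \<subseteq> ?S"
    using coord by (intro span_minimal) auto
  have b: "0 \<le> b" using bounded norm_ge_zero order_trans by blast
  show "(\<lambda>n. x n \<bullet> u) \<longlonglongrightarrow> 0 \<bullet> u"
    unfolding inner_zero_left
  proof (rule LIMSEQ_I)
    fix r :: real assume r: "0 < r"
    define d where "d = r / (2 * (b + 1))"
    have d: "0 < d" "b * d < r / 2" using r b by (auto simp: d_def field_simps)
    have "u \<in> closure (span (range e))" using basis by (simp add: orthonormal_basis_def)
    then obtain v where v: "v \<in> span (range e)" "dist v u < d"
      using d by (meson closure_approachable)
    then have "(\<lambda>n. x n \<bullet> v) \<longlonglongrightarrow> 0" using span by blast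
    then obtain N where N: "\<And>n. n \<ge> N \<Longrightarrow> norm (x n \<bullet> v - 0) < r / 2"
      using LIMSEQ_D[of "\<lambda>n. x n \<bullet> v" 0 "r / 2"] r by auto
    have "norm (x n \<bullet> u - 0) < r" if "n \<ge> N" for n
    proof -
      have "\<bar>x n \<bullet> (u - v)\<bar> \<le> norm (x n) * norm (u - v)" by (rule Cauchy_Schwarz_ineq2)
      also have "\<dots> \<le> b * d"
        using bounded v b by (intro mult_mono) (auto simp: dist_norm norm_minus_commute)
      finally show ?thesis using N[OF that] d by (simp add: inner_diff_right)
    qed
    then show "\<exists>no. \<forall>n\<ge>no. norm (x n \<bullet> u - 0) < r" by blast
  qed
qed

lemma eq_0_if_inner_basis_0:
  assumes "\<And>i. x \<bullet> e i = 0"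
  shows "x = 0"
proof -
  have "weakly_converges (\<lambda>_. x) 0"
    using assms by (intro weakly_converges_0I[of _ "norm x"]) auto
  then have "(\<lambda>_. x \<bullet> x) \<longlonglongrightarrow> 0" unfolding weakly_converges_def by (metis inner_zero_left)
  then show ?thesis by (simp add: LIMSEQ_const_iff)
qed

section \<open>The hyperplane and its projection\<close>

definition hyperplane :: "'a set" where "hyperplane = {e 0}\<^sup>\<bottom>"

definition horiz :: "'a \<Rightarrow> 'a" where "horiz x = x - (x \<bullet> e 0) *\<^sub>R e 0"

lemma mem_hyperplane: "x \<in> hyperplane \<longleftrightarrow> x \<bullet> e 0 = 0"
  by (simp add: hyperplane_def orthogonal_comp_def orthogonal_def inner_commute)

lemma subspace_hyperplane: "subspace hyperplane"
  unfolding hyperplane_def by (rule subspace_orthogonal_comp)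

lemma horiz_in_hyperplane: "horiz x \<in> hyperplane"
  by (simp add: mem_hyperplane horiz_def inner_diff_left)

lemma inner_horiz: "horiz x \<bullet> w = x \<bullet> w" if "w \<bullet> e 0 = 0"
  using that by (simp add: horiz_def inner_diff_left inner_commute[of "e 0" w])

lemma inner_horiz_basis: "horiz x \<bullet> e i = (if i = 0 then 0 else x \<bullet> e i)"
  by (simp add: horiz_def inner_diff_left)

lemma norm_eq_horiz: "(norm x)\<^sup>2 = (norm (horiz x))\<^sup>2 + (x \<bullet> e 0)\<^sup>2"
  by (simp add: horiz_def power2_norm_eq_inner inner_diff_left inner_diff_right
      power2_eq_square[of "x \<bullet> e 0"] inner_commute)

lemma proj_hyperplane: "proj hyperplane x = horiz x"
proof (rule proj_eqI)
  fix q assume "q \<in> hyperplane"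
  then show "(x - horiz x) \<bullet> (q - horiz x) \<le> 0"
    by (simp add: mem_hyperplane horiz_def inner_diff_left inner_diff_right inner_commute)
qed (rule horiz_in_hyperplane)

lemma hyperplane_split: "\<exists>v\<in>hyperplane. x - v \<in> hyperplane\<^sup>\<bottom>"
proof
  show "x - horiz x \<in> hyperplane\<^sup>\<bottom>"
    by (auto simp: orthogonal_comp_def[of hyperplane] orthogonal_def mem_hyperplane horiz_def)
qed (rule horiz_in_hyperplane)

section \<open>The generating curve and its cone\<close>

definition direction :: "real \<Rightarrow> 'a" where
  "direction \<xi> = cos (pi * (\<xi> - of_int \<lfloor>\<xi>\<rfloor>) / 2) *\<^sub>R e (nat \<lfloor>\<xi>\<rfloor> + 1)
     + sin (pi * (\<xi> - of_int \<lfloor>\<xi>\<rfloor>) / 2) *\<^sub>R e (nat \<lfloor>\<xi>\<rfloor> + 2)"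

definition spiral :: "real \<Rightarrow> 'a" where
  "spiral \<xi> = exp (- 100 * \<xi> ^ 3) *\<^sub>R e 0 + direction \<xi>"

definition hundal_cone :: "'a set" where
  "hundal_cone = closed_convex_cone_hull {spiral \<xi> | \<xi>. \<xi> \<ge> 0}"

text \<open>The right endpoint is included because the formulas of adjacent cells agree there, both
  giving \<open>e (k + 2)\<close>; this lets estimates on closed cells be chained.\<close>

lemma direction_cell:
  assumes "real k \<le> \<xi>" "\<xi> \<le> real k + 1"
  shows "direction \<xi> = cos (pi * (\<xi> - k) / 2) *\<^sub>R e (k + 1) + sin (pi * (\<xi> - k) / 2) *\<^sub>R e (k + 2)"
proof (cases "\<xi> = real k + 1")
  case True
  then have fl: "\<lfloor>\<xi>\<rfloor> = int (Suc k)" by simp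
  have "nat \<lfloor>\<xi>\<rfloor> = Suc k" "real_of_int \<lfloor>\<xi>\<rfloor> = real k + 1"
    unfolding fl by (simp_all only: nat_int of_int_of_nat_eq of_nat_Suc add.commute)
  then show ?thesis using True by (simp add: direction_def)
next
  case False
  then have "\<lfloor>\<xi>\<rfloor> = int k" using assms by (intro floor_unique) auto
  then show ?thesis by (simp add: direction_def)
qed

lemma obtain_cell:
  assumes "0 \<le> \<xi>"
  obtains k where "real k \<le> \<xi>" "\<xi> < real k + 1"
proof
  show "real (nat \<lfloor>\<xi>\<rfloor>) \<le> \<xi>" "\<xi> < real (nat \<lfloor>\<xi>\<rfloor>) + 1" using assms by linarith+
qed

lemma inner_spiral_0 [simp]: "spiral \<xi> \<bullet> e 0 = exp (- 100 * \<xi> ^ 3)"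
  by (simp add: spiral_def direction_def inner_add_left)

lemma inner_direction_0 [simp]: "direction \<xi> \<bullet> e 0 = 0"
  by (simp add: direction_def inner_add_left)

lemma horiz_spiral: "horiz (spiral \<xi>) = direction \<xi>"
  by (simp add: horiz_def) (simp add: spiral_def)

lemma norm_direction: "norm (direction \<xi>) = 1"
proof -
  have "direction \<xi> \<bullet> direction \<xi> = 1"
    by (simp add: direction_def inner_add_left inner_add_right inner_commute
        flip: power2_eq_square)
  then show ?thesis by (simp add: norm_eq_1)
qed

lemma cell_angle:
  assumes "real k \<le> \<xi>" "\<xi> \<le> real k + 1"
  shows "0 \<le> cos (pi * (\<xi> - k) / 2)" "0 \<le> sin (pi * (\<xi> - k) / 2)"
proof -
  have *: "0 \<le> pi * (\<xi> - k) / 2" "pi * (\<xi> - k) / 2 \<le> pi / 2"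
    using assms by (simp_all add: mult_left_le)
  then show "0 \<le> cos (pi * (\<xi> - k) / 2)" using pi_gt_zero by (intro cos_ge_zero) linarith+
  show "0 \<le> sin (pi * (\<xi> - k) / 2)" using * pi_gt_zero by (intro sin_ge_zero) linarith+
qed

lemma hundal_cone_closed: "closed hundal_cone" "convex hundal_cone" "cone hundal_cone"
proof -
  have "closed hundal_cone \<and> convex hundal_cone \<and> cone hundal_cone"
    unfolding hundal_cone_def closed_convex_cone_hull_def
    by (rule hull_in) (auto intro: closed_Inter convex_Inter cone_Inter)
  then show "closed hundal_cone" "convex hundal_cone" "cone hundal_cone" by auto
qed

lemma spiral_in_cone: "0 \<le> \<xi> \<Longrightarrow> spiral \<xi> \<in> hundal_cone"
  unfolding hundal_cone_def closed_convex_cone_hull_def by (rule hull_inc) auto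

lemma hundal_cone_nonempty: "hundal_cone \<noteq> {}"
  using spiral_in_cone[of 0] by auto

text \<open>A closed half-space with 0 on its boundary is a closed convex cone, so a homogeneous
  linear inequality need only be checked on the generators.\<close>

lemma hundal_cone_inner_ge_0:
  assumes "z \<in> hundal_cone" "\<And>\<xi>. 0 \<le> \<xi> \<Longrightarrow> 0 \<le> w \<bullet> spiral \<xi>"
  shows "0 \<le> w \<bullet> z"
proof -
  have "hundal_cone \<subseteq> {z. 0 \<le> w \<bullet> z}"
    unfolding hundal_cone_def closed_convex_cone_hull_def
    using assms(2) closed_halfspace_ge[of 0 w] convex_halfspace_ge[of 0 w]
    by (intro hull_minimal) (auto simp: cone_def)
  then show ?thesis using assms(1) by blast
qed

text \<open>For positive \<open>i\<close>, only generators with \<open>\<xi> \<le> i\<close> can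
  have a nonzero coordinate along \<open>e i\<close>, and their height is at least
  \<open>exp (- 100 * i ^ 3)\<close>.\<close>

lemma hundal_cone_coord:
  assumes z: "z \<in> hundal_cone"
  shows "0 \<le> z \<bullet> e i" and "z \<bullet> e i \<le> exp (100 * real i ^ 3) * (z \<bullet> e 0)"
proof -
  have dir: "0 \<le> direction \<xi> \<bullet> e j" if \<xi>: "0 \<le> \<xi>" for \<xi> j
  proof -
    obtain k where k: "real k \<le> \<xi>" "\<xi> < real k + 1" using \<xi> by (rule obtain_cell)
    then show ?thesis
      using cell_angle[of k \<xi>] by (simp add: direction_cell[of k] inner_add_left)
  qed
  have "0 \<le> e i \<bullet> spiral \<xi>" if "0 \<le> \<xi>" for \<xi>
    using that dir[of \<xi> i] by (simp add: spiral_def inner_add_right inner_commute[of _ "direction \<xi>"])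
  from hundal_cone_inner_ge_0[OF z this] show "0 \<le> z \<bullet> e i" by (simp add: inner_commute)
  have "0 \<le> (exp (100 * real i ^ 3) *\<^sub>R e 0 - e i) \<bullet> spiral \<xi>" if \<xi>: "0 \<le> \<xi>" for \<xi>
  proof (cases "i = 0 \<or> direction \<xi> \<bullet> e i = 0")
    case True
    then show ?thesis
      by (auto simp: spiral_def inner_add_right inner_diff_left inner_diff_right
          inner_commute[of _ "direction \<xi>"])
  next
    case False
    obtain k where k: "real k \<le> \<xi>" "\<xi> < real k + 1" using \<xi> by (rule obtain_cell)
    with False have "k + 1 \<le> i"
      by (auto simp: direction_cell[of k] inner_add_left split: if_splits)
    then have "\<xi> \<le> real i" using k by linarith
    then have "\<xi> ^ 3 \<le> real i ^ 3" using \<xi> by (rule power_mono)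
    then have "1 \<le> exp (- 100 * \<xi> ^ 3) * exp (100 * real i ^ 3)"
      unfolding exp_add[symmetric] by simp
    moreover have "direction \<xi> \<bullet> e i \<le> norm (direction \<xi>) * norm (e i)"
      by (rule norm_cauchy_schwarz)
    ultimately show ?thesis
      using False
      by (simp add: spiral_def inner_add_right inner_diff_left inner_diff_right
          inner_commute[of _ "direction \<xi>"] norm_direction norm_eq_sqrt_inner[of "e i"])
  qed
  from hundal_cone_inner_ge_0[OF z this]
  show "z \<bullet> e i \<le> exp (100 * real i ^ 3) * (z \<bullet> e 0)"
    by (simp add: inner_diff_right inner_commute[of _ z])
qed

lemma hundal_cone_eq_0:
  assumes "z \<in> hundal_cone" "z \<bullet> e 0 = 0"
  shows "z = 0"
  using assms hundal_cone_coord[OF assms(1)] by (intro eq_0_if_inner_basis_0) (auto intro: antisym)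

text \<open>Generators lagging behind \<open>t\<close> by more than \<open>\<eta>\<close> are so high that the last term
  absorbs them; those lagging by at most \<open>\<eta>\<close> make an angle small enough for the middle term.\<close>

lemma rotation_ge:
  assumes z: "z \<in> hundal_cone" and k: "real k \<le> t" "t \<le> real k + 1"
    and \<eta>: "0 \<le> \<eta>" "\<eta> \<le> 1 / 20" "\<eta> \<le> t"
  defines "\<theta> \<equiv> pi * (t - k) / 2"
  shows "0 \<le> pi / 2 * (cos \<theta> * (z \<bullet> e (k + 2)) - sin \<theta> * (z \<bullet> e (k + 1)))
      + 3 * \<eta> * (z \<bullet> direction t) + pi / 2 * exp (100 * (t - \<eta>) ^ 3) * (z \<bullet> e 0)"
proof -
  \<comment> \<open>The first two terms, paired with \<open>z\<close>, give the derivative of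
    \<open>z \<bullet> direction t\<close> in \<open>t\<close>; the others are corrections that
    place \<open>w\<close> in the dual cone.\<close>
  define w where "w = (pi / 2 * cos \<theta>) *\<^sub>R e (k + 2) - (pi / 2 * sin \<theta>) *\<^sub>R e (k + 1)
      + (3 * \<eta>) *\<^sub>R direction t + (pi / 2 * exp (100 * (t - \<eta>) ^ 3)) *\<^sub>R e 0"
  have dir: "direction t = cos \<theta> *\<^sub>R e (k + 1) + sin \<theta> *\<^sub>R e (k + 2)"
    using direction_cell[OF k] by (simp add: \<theta>_def)
  have ang: "0 \<le> cos \<theta>" "0 \<le> sin \<theta>" using cell_angle[OF k] by (auto simp: \<theta>_def)
  have "0 \<le> w \<bullet> spiral s" if s: "0 \<le> s" for s
  proof -
    define h where "h = exp (100 * (t - \<eta>) ^ 3) * exp (- 100 * s ^ 3)"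
    have h0: "0 \<le> h" by (simp add: h_def)
    obtain m where m: "real m \<le> s" "s < real m + 1" using s by (rule obtain_cell)
    define \<phi> where "\<phi> = pi * (s - m) / 2"
    have dir_s: "direction s = cos \<phi> *\<^sub>R e (m + 1) + sin \<phi> *\<^sub>R e (m + 2)"
      using direction_cell[of m s] m by (simp add: \<phi>_def)
    have ang_s: "0 \<le> cos \<phi>" "0 \<le> sin \<phi>" using cell_angle[of m s] m by (auto simp: \<phi>_def)
    define c where "c = direction s \<bullet> e (k + 1)"
    define d where "d = direction s \<bullet> e (k + 2)"
    have c: "c = (if m = k then cos \<phi> else if m + 1 = k then sin \<phi> else 0)"
      by (auto simp: c_def dir_s inner_add_left)
    have d: "d = (if m = k then sin \<phi> else if m = k + 1 then cos \<phi> else 0)"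
      by (auto simp: d_def dir_s inner_add_left)
    have cd: "0 \<le> c" "0 \<le> d" "c \<le> 1" using ang_s by (auto simp: c d)
    have w: "w \<bullet> spiral s = pi / 2 * (cos \<theta> * d - sin \<theta> * c) + 3 * \<eta> * (cos \<theta> * c + sin \<theta> * d) + pi / 2 * h"
    proof -
      have "w \<bullet> spiral s = pi / 2 * cos \<theta> * d - pi / 2 * sin \<theta> * c
          + 3 * \<eta> * (cos \<theta> * c + sin \<theta> * d) + pi / 2 * h"
        unfolding w_def dir c_def d_def h_def
        by (simp add: spiral_def inner_add_left inner_diff_left inner_add_right
            inner_diff_right inner_commute[of _ "direction s"])
      then show ?thesis by (simp add: algebra_simps)
    qed
    have pos: "0 \<le> 3 * \<eta> * (cos \<theta> * c + sin \<theta> * d)" "0 \<le> pi / 2 * (cos \<theta> * d)"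
      using \<eta> ang cd by auto
    \<comment> \<open>The only negative contribution is \<open>- sin \<theta> * c\<close>, and
      \<open>c\<close> vanishes unless \<open>s\<close> lies in the cell of \<open>t\<close> or in
      the preceding one.\<close>
    consider "s < t - \<eta>" | "t - \<eta> \<le> s" "m = k" | "t - \<eta> \<le> s" "m + 1 = k" | "c = 0"
      by (cases "s < t - \<eta>"; cases "m = k"; cases "m + 1 = k"; simp add: c)
    then show ?thesis
    proof cases
      case 1
      then have "s ^ 3 \<le> (t - \<eta>) ^ 3" using s by (intro power_mono) auto
      then have "1 \<le> h" unfolding h_def exp_add[symmetric] by simp
      moreover have "sin \<theta> * c \<le> 1" using ang cd by (intro mult_le_one) auto
      ultimately have "pi / 2 * (sin \<theta> * c) \<le> pi / 2 * h" by (intro mult_left_mono) auto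
      then show ?thesis using pos unfolding w right_diff_distrib by linarith
    next
      case 2
      have eq: "cos \<theta> * d - sin \<theta> * c = sin (\<phi> - \<theta>)" "cos \<theta> * c + sin \<theta> * d = cos (\<phi> - \<theta>)"
        using 2 by (simp_all add: c d sin_diff cos_diff algebra_simps)
      have "0 \<le> pi / 2 * sin (\<phi> - \<theta>) + 3 * \<eta> * cos (\<phi> - \<theta>)"
      proof (cases "s \<ge> t")
        case True
        then have "\<theta> \<le> \<phi>" using 2 by (simp add: \<phi>_def \<theta>_def divide_right_mono)
        moreover have "\<phi> \<le> pi / 2" "0 \<le> \<theta>"
          using m k by (auto simp: \<phi>_def \<theta>_def mult_left_le)
        ultimately show ?thesis
          using \<eta> by (intro add_nonneg_nonneg mult_nonneg_nonneg sin_ge_zero cos_ge_zero) auto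
      next
        case False
        have lag: "\<theta> - \<phi> = pi * (t - s) / 2" using 2 by (simp add: \<phi>_def \<theta>_def field_simps)
        have "pi / 2 * sin (\<theta> - \<phi>) \<le> 3 * \<eta> * cos (\<theta> - \<phi>)"
          unfolding lag using False 2 \<eta> by (intro small_angle_le) auto
        then show ?thesis
          by (simp add: sin_diff cos_diff algebra_simps)
      qed
      then show ?thesis unfolding w eq using h0 by simp
    next
      \<comment> \<open>Here \<open>s < k\<close>, so \<open>t - k\<close> is at most
        \<open>\<eta>\<close> and the small angle estimate applies to \<open>\<theta>\<close>
        itself.\<close>
      case 3
      have "\<theta> \<le> pi * \<eta> / 2" using 3 m by (simp add: \<theta>_def)
      then have "pi / 2 * sin \<theta> \<le> 3 * \<eta> * cos \<theta>"
        using k \<eta> by (intro small_angle_le) (auto simp: \<theta>_def)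
      from mult_right_mono[OF this cd(1)]
      have "pi / 2 * (sin \<theta> * c) \<le> 3 * \<eta> * (cos \<theta> * c)" by (simp add: mult.assoc)
      moreover have "0 \<le> 3 * \<eta> * (sin \<theta> * d)" using \<eta> ang cd by simp
      ultimately show ?thesis
        using pos h0 pi_gt_zero mult_nonneg_nonneg[of "pi / 2" h]
        unfolding w right_diff_distrib distrib_left by linarith
    next
      case 4
      then show ?thesis unfolding w using pos h0 by simp
    qed
  qed
  from hundal_cone_inner_ge_0[OF z this] have "0 \<le> w \<bullet> z" .
  then show ?thesis
    by (simp add: w_def inner_add_left inner_diff_left inner_commute[of z] algebra_simps)
qed

text \<open>By \<open>rotation_ge\<close> with lag \<open>1 / (20 * x * sqrt x)\<close>, the inner
  product decreases at rate at most \<open>1 / (5 * x * sqrt x)\<close>, which is minus the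
  derivative of \<open>2 / (5 * sqrt x)\<close>.\<close>

lemma direction_progress_cell:
  assumes z: "z \<in> hundal_cone" "norm z \<le> 1" and k: "real k \<le> s" "t \<le> real k + 1"
    and st: "1 \<le> s" "s \<le> t" and height: "z \<bullet> e 0 \<le> exp (- 100 * t ^ 3)"
  shows "z \<bullet> direction s - 2 / (5 * sqrt s) \<le> z \<bullet> direction t - 2 / (5 * sqrt t)"
proof -
  \<comment> \<open>The formula of cell \<open>k\<close> is used for all \<open>x\<close>, since
    \<open>direction\<close> has corners at the integers and the derivative is also needed at the
    ends.\<close>
  define F where "F x = cos (pi * (x - k) / 2) * (z \<bullet> e (k + 1))
    + sin (pi * (x - k) / 2) * (z \<bullet> e (k + 2)) - 2 / (5 * sqrt x)" for x :: real
  have F: "z \<bullet> direction x - 2 / (5 * sqrt x) = F x" if "s \<le> x" "x \<le> t" for x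
    using direction_cell[of k x] that k by (simp add: F_def inner_add_right)
  have "F s \<le> F t"
  proof (rule DERIV_nonneg_imp_nondecreasing[OF st(2)], intro exI conjI)
    fix x assume x: "s \<le> x" "x \<le> t"
    define \<theta> where "\<theta> = pi * (x - k) / 2"
    define T where "T = x * sqrt x"
    have x1: "1 \<le> x" using x st by simp
    then have T: "1 \<le> T" unfolding T_def using mult_mono[of 1 x 1 "sqrt x"] by simp
    let ?D = "pi / 2 * (cos \<theta> * (z \<bullet> e (k + 2)) - sin \<theta> * (z \<bullet> e (k + 1)))"
    show "(F has_real_derivative ?D + 1 / (5 * T)) (at x)"
    proof -
      have trig: "((\<lambda>x. cos (pi * (x - k) / 2) * (z \<bullet> e (k + 1))
          + sin (pi * (x - k) / 2) * (z \<bullet> e (k + 2))) has_real_derivative ?D) (at x)"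
        unfolding \<theta>_def by (auto intro!: derivative_eq_intros simp: field_simps)
      have root: "((\<lambda>x. 2 / (5 * sqrt x)) has_real_derivative - (1 / (5 * T))) (at x)"
        using x1 by (auto intro!: derivative_eq_intros simp: T_def field_simps)
      show ?thesis using DERIV_diff[OF trig root] unfolding F_def by simp
    qed
    have z0: "0 \<le> z \<bullet> e 0" using hundal_cone_coord(1) z by blast
    have "0 \<le> ?D + 3 * (1 / (20 * T)) * (z \<bullet> direction x)
        + pi / 2 * exp (100 * (x - 1 / (20 * T)) ^ 3) * (z \<bullet> e 0)"
      unfolding \<theta>_def
    proof (rule rotation_ge)
      have "1 / (20 * T) \<le> 1 / 20" using T by (simp add: field_simps)
      then show "1 / (20 * T) \<le> 1 / 20" "1 / (20 * T) \<le> x" using x1 by linarith+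
    qed (use z k x T in auto)
    moreover have "3 * (1 / (20 * T)) * (z \<bullet> direction x) \<le> 3 * (1 / (20 * T)) * 1"
    proof (rule mult_left_mono)
      show "z \<bullet> direction x \<le> 1"
        using norm_cauchy_schwarz[of z "direction x"] z(2) by (simp add: norm_direction)
    qed (use T in simp)
    moreover have "pi / 2 * exp (100 * (x - 1 / (20 * T)) ^ 3) * (z \<bullet> e 0) \<le> 2 * (1 / (100 * T))"
    proof -
      have "x ^ 3 \<le> t ^ 3" using x x1 by (intro power_mono) auto
      then have "exp (- 100 * t ^ 3) \<le> exp (- 100 * x ^ 3)" by simp
      with height have "z \<bullet> e 0 \<le> exp (- 100 * x ^ 3)" by (rule order_trans)
      then have "(z \<bullet> e 0) * exp (100 * (x - 1 / (20 * T)) ^ 3)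
          \<le> exp (- 100 * x ^ 3) * exp (100 * (x - 1 / (20 * T)) ^ 3)"
        by (intro mult_right_mono) auto
      also have "\<dots> \<le> 1 / (100 * T)"
        unfolding T_def by (rule height_ratio_le[OF x1])
      finally have "pi / 2 * ((z \<bullet> e 0) * exp (100 * (x - 1 / (20 * T)) ^ 3)) \<le> 2 * (1 / (100 * T))"
        using pi_less_4 z0 by (intro mult_mono) auto
      then show ?thesis by (simp add: mult_ac)
    qed
    \<comment> \<open>Numerically \<open>3 / 20 + 1 / 50 = 17 / 100\<close>, below
      \<open>1 / 5\<close>.\<close>
    moreover have "3 * (1 / (20 * T)) * 1 + 2 * (1 / (100 * T)) \<le> 1 / (5 * T)"
      using T by (simp add: field_simps)
    ultimately show "0 \<le> ?D + 1 / (5 * T)" by linarith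
  qed
  then show ?thesis using F[of s] F[of t] st by simp
qed

text \<open>Cells are chained by induction on an integer bound for \<open>t\<close>; the height
  condition at \<open>t\<close> passes to smaller arguments because the height decreases along the
  curve.\<close>

lemma direction_progress:
  assumes z: "z \<in> hundal_cone" "norm z \<le> 1"
    and st: "1 \<le> s" "s \<le> t" and height: "z \<bullet> e 0 \<le> exp (- 100 * t ^ 3)"
  shows "z \<bullet> direction s - 2 / (5 * sqrt s) \<le> z \<bullet> direction t - 2 / (5 * sqrt t)"
proof -
  have "z \<bullet> direction s - 2 / (5 * sqrt s) \<le> z \<bullet> direction t - 2 / (5 * sqrt t)"
    if "s \<le> t" "z \<bullet> e 0 \<le> exp (- 100 * t ^ 3)" "t \<le> real m" for m t
    using that
  proof (induction m arbitrary: t)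
    case 0
    then show ?case using st by simp
  next
    case (Suc m)
    consider "t \<le> real m" | "real m \<le> s" | "s \<le> real m" "real m \<le> t" by linarith
    then show ?case
    proof cases
      case 1
      then show ?thesis using Suc by blast
    next
      case 2
      then show ?thesis
        using Suc.prems st z by (intro direction_progress_cell[of z m]) auto
    next
      case 3
      then have "real m ^ 3 \<le> t ^ 3" by (intro power_mono) auto
      then have "exp (- 100 * t ^ 3) \<le> exp (- 100 * real m ^ 3)" by simp
      with Suc.prems(2) have "z \<bullet> e 0 \<le> exp (- 100 * real m ^ 3)" by (rule order_trans)
      then have "z \<bullet> direction s - 2 / (5 * sqrt s) \<le> z \<bullet> direction m - 2 / (5 * sqrt m)"
        using 3 Suc.prems by (intro Suc.IH) auto
      also have "\<dots> \<le> z \<bullet> direction t - 2 / (5 * sqrt t)"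
        using 3 Suc.prems st z by (intro direction_progress_cell[of z m]) auto
      finally show ?thesis .
    qed
  qed
  then show ?thesis using st height real_arch_simple[of t] by blast
qed

section \<open>Alternating projections\<close>

text \<open>The point \<open>z\<close> competes with \<open>z'\<close> at a distance equal to its
  own height, while \<open>z'\<close> is no closer than its height. The norm estimate applies
  Pythagoras twice, once at \<open>z'\<close> and once along \<open>e 0\<close>; the last claim
  tests polarity on a generator.\<close>

lemma proj_hundal_cone_step:
  assumes z: "z \<in> hundal_cone"
  defines "z' \<equiv> proj hundal_cone (horiz z)"
  shows "z' \<in> hundal_cone" "z' \<bullet> e 0 \<le> z \<bullet> e 0" "norm z' \<le> norm (horiz z)"
    "(norm (horiz z'))\<^sup>2 + 2 * (z' \<bullet> e 0)\<^sup>2 \<le> (norm (horiz z))\<^sup>2"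
    "0 \<le> \<xi> \<Longrightarrow> horiz z \<bullet> direction \<xi> - (z' \<bullet> e 0) * exp (- 100 * \<xi> ^ 3) \<le> horiz z' \<bullet> direction \<xi>"
proof -
  note K = hundal_cone_closed hundal_cone_nonempty
  let ?w = "horiz z"
  have near: "z' \<in> hundal_cone" "\<forall>q\<in>hundal_cone. dist ?w z' \<le> dist ?w q"
    using proj_nearest[OF K(1,2,4), of ?w] by (auto simp: z'_def)
  show "z' \<in> hundal_cone" by fact
  have orth: "(?w - z') \<bullet> z' = 0"
    unfolding z'_def by (rule proj_cone_inner(1)[OF K])
  have polar: "(?w - z') \<bullet> q \<le> 0" if "q \<in> hundal_cone" for q
    unfolding z'_def by (rule proj_cone_inner(2)[OF K that])
  have w0: "?w \<bullet> e 0 = 0" using horiz_in_hyperplane mem_hyperplane by blast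
  have pos: "0 \<le> z \<bullet> e 0" "0 \<le> z' \<bullet> e 0"
    using hundal_cone_coord(1) z near(1) by blast+
  have "\<bar>(?w - z') \<bullet> e 0\<bar> \<le> norm (?w - z') * norm (e 0)" by (rule Cauchy_Schwarz_ineq2)
  then have gap: "z' \<bullet> e 0 \<le> norm (?w - z')"
    using w0 pos by (simp add: inner_diff_left norm_eq_sqrt_inner[of "e 0"])
  also have "\<dots> \<le> norm (?w - z)" using near(2) z by (simp add: dist_norm)
  also have "\<dots> = z \<bullet> e 0"
    using pos by (simp add: horiz_def norm_eq_sqrt_inner[of "e 0"])
  finally show "z' \<bullet> e 0 \<le> z \<bullet> e 0" .
  have pyth: "(norm ?w)\<^sup>2 = (norm (?w - z'))\<^sup>2 + (norm z')\<^sup>2"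
    using orth by (simp add: power2_norm_eq_inner inner_diff_left inner_diff_right inner_commute)
  then have "(norm z')\<^sup>2 \<le> (norm ?w)\<^sup>2" by simp
  then show "norm z' \<le> norm ?w" by (rule power2_le_imp_le) simp
  have "(z' \<bullet> e 0)\<^sup>2 \<le> (norm (?w - z'))\<^sup>2" using gap pos by (intro power_mono)
  then show "(norm (horiz z'))\<^sup>2 + 2 * (z' \<bullet> e 0)\<^sup>2 \<le> (norm ?w)\<^sup>2"
    using pyth norm_eq_horiz[of z'] by linarith
  show "?w \<bullet> direction \<xi> - (z' \<bullet> e 0) * exp (- 100 * \<xi> ^ 3) \<le> horiz z' \<bullet> direction \<xi>" if "0 \<le> \<xi>"
    using polar[OF spiral_in_cone[OF that]] w0 inner_horiz[of "direction \<xi>" z']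
    by (simp add: spiral_def inner_add_right inner_diff_left algebra_simps)
qed

section \<open>The sequence in the cone and its invariant\<close>

text \<open>The iterates are recorded in the cone to keep their heights. The start
  \<open>spiral 1\<close> has horizontal part \<open>direction 1 = e 2\<close>, the prescribed
  starting point.\<close>

definition alternating :: "nat \<Rightarrow> 'a" where
  "alternating n = ((\<lambda>z. proj hundal_cone (horiz z)) ^^ n) (spiral 1)"

lemma alternating_0: "alternating 0 = spiral 1"
  by (simp add: alternating_def)

lemma alternating_Suc: "alternating (Suc n) = proj hundal_cone (horiz (alternating n))"
  by (simp add: alternating_def)

lemma alternating_in_cone: "alternating n \<in> hundal_cone"
  by (induction n) (simp_all add: alternating_0 alternating_Suc spiral_in_cone proj_hundal_cone_step)

lemma norm_horiz_alternating_decreasing: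
  "(norm (horiz (alternating (Suc n))))\<^sup>2 + 2 * (alternating (Suc n) \<bullet> e 0)\<^sup>2
    \<le> (norm (horiz (alternating n)))\<^sup>2"
  using proj_hundal_cone_step(4)[OF alternating_in_cone[of n]] by (simp add: alternating_Suc)

lemma norm_horiz_alternating_le: "norm (horiz (alternating n)) \<le> 1"
proof (induction n)
  case 0
  then show ?case by (simp add: alternating_0 horiz_spiral norm_direction)
next
  case (Suc n)
  have "(norm (horiz (alternating (Suc n))))\<^sup>2 \<le> (norm (horiz (alternating n)))\<^sup>2"
    using norm_horiz_alternating_decreasing[of n] zero_le_power2[of "alternating (Suc n) \<bullet> e 0"] by linarith
  then have "norm (horiz (alternating (Suc n))) \<le> norm (horiz (alternating n))"
    by (rule power2_le_imp_le) simp
  then show ?case using Suc by simp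
qed

text \<open>The quantity on the right is nondecreasing in \<open>n\<close>. The loss \<open>\<phi> \<phi>'\<close> of the inner product in one step
  is paid for by the loss \<open>2 \<phi>'\<^sup>2\<close> of the squared norm, and the rotation of the direction by
  the term \<open>2 / (5 * sqrt \<xi>)\<close>.\<close>

lemma alternating_invariant:
  "\<exists>\<xi>\<ge>1. exp (- 100 * \<xi> ^ 3) = alternating n \<bullet> e 0 \<and>
    1 / 20 \<le> horiz (alternating n) \<bullet> direction \<xi> - 2 / (5 * sqrt \<xi>)
      - (norm (horiz (alternating n)))\<^sup>2 / 2 - (alternating n \<bullet> e 0)\<^sup>2 / 2"
proof (induction n)
  case 0
  \<comment> \<open>The initial value is \<open>1 - 2 / 5 - 1 / 2 = 1 / 10\<close> up to half the
    squared height; \<open>1 / 20\<close> leaves room for the latter.\<close>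
  have "exp (- 100 :: real) \<le> 1 / 10"
    using exp_ge_add_one_self[of "100::real"] by (simp add: exp_minus field_simps)
  then have "(exp (- 100 :: real))\<^sup>2 \<le> (1 / 10)\<^sup>2" by (intro power_mono) auto
  moreover have "direction 1 \<bullet> direction 1 = 1"
    by (simp add: norm_direction flip: power2_norm_eq_inner)
  ultimately show ?case
    by (intro exI[of _ 1]) (simp add: alternating_0 horiz_spiral norm_direction power2_eq_square)
next
  case (Suc n)
  define z where "z = alternating n"
  define z' where "z' = alternating (Suc n)"
  have zK: "z \<in> hundal_cone" by (simp add: z_def alternating_in_cone)
  have z': "z' = proj hundal_cone (horiz z)" by (simp add: z_def z'_def alternating_Suc)
  note step = proj_hundal_cone_step[OF zK, folded z']
  obtain \<xi> where \<xi>: "1 \<le> \<xi>" "exp (- 100 * \<xi> ^ 3) = z \<bullet> e 0"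
    and inv: "1 / 20 \<le> horiz z \<bullet> direction \<xi> - 2 / (5 * sqrt \<xi>)
      - (norm (horiz z))\<^sup>2 / 2 - (z \<bullet> e 0)\<^sup>2 / 2"
    using Suc by (auto simp: z_def)
  have prog: "horiz z \<bullet> direction \<xi> - (z' \<bullet> e 0) * (z \<bullet> e 0) \<le> horiz z' \<bullet> direction \<xi>"
    using step(5)[of \<xi>] \<xi> by simp
  have pos: "0 \<le> z' \<bullet> e 0" using hundal_cone_coord(1) step(1) by blast
  \<comment> \<open>Positive height is needed to find a parameter with that height on the curve;
    height 0 would mean \<open>z' = 0\<close>, and the inner product could not stay
    positive.\<close>
  have "z' \<bullet> e 0 \<noteq> 0"
  proof
    assume 0: "z' \<bullet> e 0 = 0"
    then have "z' = 0" using hundal_cone_eq_0 step(1) by blast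
    then have "horiz z \<bullet> direction \<xi> \<le> 0" using prog by (simp add: horiz_def)
    moreover have "0 \<le> 2 / (5 * sqrt \<xi>)" using \<xi> by simp
    ultimately show False
      using inv zero_le_power2[of "norm (horiz z)"] zero_le_power2[of "z \<bullet> e 0"] by linarith
  qed
  then have pos': "0 < z' \<bullet> e 0" using pos by simp
  define \<xi>' where "\<xi>' = root 3 (- ln (z' \<bullet> e 0) / 100)"
  have cube: "\<xi>' ^ 3 = - ln (z' \<bullet> e 0) / 100"
    unfolding \<xi>'_def by (rule odd_real_root_pow) simp
  then have height: "exp (- 100 * \<xi>' ^ 3) = z' \<bullet> e 0" using pos' by simp
  have "z' \<bullet> e 0 \<le> exp (- 100 * \<xi> ^ 3)" using \<xi>(2) step(2) by simp
  then have "ln (z' \<bullet> e 0) \<le> - 100 * \<xi> ^ 3"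
    using pos' ln_le_cancel_iff[of "z' \<bullet> e 0" "exp (- 100 * \<xi> ^ 3)"] by simp
  then have "root 3 (\<xi> ^ 3) \<le> \<xi>'" unfolding \<xi>'_def by (intro real_root_le_mono) auto
  then have "\<xi> \<le> \<xi>'" using \<xi>(1) by (simp add: real_root_power_cancel)
  have "z' \<bullet> direction \<xi> - 2 / (5 * sqrt \<xi>) \<le> z' \<bullet> direction \<xi>' - 2 / (5 * sqrt \<xi>')"
  proof (rule direction_progress)
    show "norm z' \<le> 1"
      using step(3) norm_horiz_alternating_le[of n] by (simp add: z_def)
  qed (use step(1) \<xi> \<open>\<xi> \<le> \<xi>'\<close> height in auto)
  then have "horiz z' \<bullet> direction \<xi> - 2 / (5 * sqrt \<xi>) \<le> horiz z' \<bullet> direction \<xi>' - 2 / (5 * sqrt \<xi>')"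
    by (simp add: inner_horiz)
  \<comment> \<open>Half the drop of the squared norm is at least the square of the new height: one
    half of it covers this product bound, the other the new last term. The old last term supplies
    the rest.\<close>
  moreover have "2 * ((z' \<bullet> e 0) * (z \<bullet> e 0)) \<le> (z' \<bullet> e 0)\<^sup>2 + (z \<bullet> e 0)\<^sup>2"
    using sum_squares_bound[of "z' \<bullet> e 0" "z \<bullet> e 0"] by (simp add: mult.assoc)
  ultimately have "1 / 20 \<le> horiz z' \<bullet> direction \<xi>' - 2 / (5 * sqrt \<xi>')
      - (norm (horiz z'))\<^sup>2 / 2 - (z' \<bullet> e 0)\<^sup>2 / 2"
    using inv prog step(4) by linarith
  then show ?case
    using \<xi>(1) \<open>\<xi> \<le> \<xi>'\<close> height unfolding z'_def by (intro exI[of _ \<xi>']) simp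
qed

lemma norm_horiz_alternating_ge: "1 / 20 \<le> norm (horiz (alternating n))"
proof -
  obtain \<xi> where "1 \<le> \<xi>" and *: "1 / 20 \<le> horiz (alternating n) \<bullet> direction \<xi> - 2 / (5 * sqrt \<xi>)
      - (norm (horiz (alternating n)))\<^sup>2 / 2 - (alternating n \<bullet> e 0)\<^sup>2 / 2"
    using alternating_invariant by blast
  then have "0 \<le> 2 / (5 * sqrt \<xi>)" by simp
  then have "1 / 20 \<le> horiz (alternating n) \<bullet> direction \<xi>"
    using * zero_le_power2[of "norm (horiz (alternating n))"] zero_le_power2[of "alternating n \<bullet> e 0"]
    by linarith
  also have "\<dots> \<le> norm (horiz (alternating n))"
    using norm_cauchy_schwarz[of "horiz (alternating n)" "direction \<xi>"] by (simp add: norm_direction)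
  finally show ?thesis .
qed

section \<open>Weak but not strong convergence\<close>

lemma alternating_height_tendsto_0: "(\<lambda>n. alternating n \<bullet> e 0) \<longlonglongrightarrow> 0"
proof -
  let ?a = "\<lambda>n. (norm (horiz (alternating n)))\<^sup>2"
  have "decseq ?a"
    by (rule decseq_SucI)
      (use norm_horiz_alternating_decreasing in \<open>smt (verit) zero_le_power2\<close>)
  then obtain L where L: "?a \<longlonglongrightarrow> L"
    by (rule decseq_convergent[where B = 0]) auto
  have "(\<lambda>n. (?a n - ?a (Suc n)) / 2) \<longlonglongrightarrow> (L - L) / 2"
    by (intro tendsto_intros L LIMSEQ_Suc[OF L]) simp
  then have lim: "(\<lambda>n. (?a n - ?a (Suc n)) / 2) \<longlonglongrightarrow> 0" by simp
  have "(\<lambda>n. (alternating (Suc n) \<bullet> e 0)\<^sup>2) \<longlonglongrightarrow> 0"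
  proof (rule tendsto_sandwich[OF _ _ tendsto_const lim])
    have "(alternating (Suc n) \<bullet> e 0)\<^sup>2 \<le> (?a n - ?a (Suc n)) / 2" for n
      using norm_horiz_alternating_decreasing[of n] by simp
    then show "\<forall>\<^sub>F n in sequentially. (alternating (Suc n) \<bullet> e 0)\<^sup>2 \<le> (?a n - ?a (Suc n)) / 2"
      by simp
  qed simp
  then have "(\<lambda>n. alternating (Suc n) \<bullet> e 0) \<longlonglongrightarrow> 0"
    by (simp add: tendsto_power_zero)
  then show ?thesis by (rule LIMSEQ_imp_Suc)
qed

text \<open>Each coordinate is squeezed between 0 and a fixed multiple of the height. The index is
  shifted because \<open>x n\<close> equals \<open>y (Suc n)\<close>.\<close>

lemma horiz_alternating_weakly_converges: "weakly_converges (\<lambda>n. horiz (alternating (Suc n))) 0"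
proof (rule weakly_converges_0I[OF norm_horiz_alternating_le])
  fix i
  have "(\<lambda>n. alternating n \<bullet> e i) \<longlonglongrightarrow> 0"
  proof (rule tendsto_sandwich[OF _ _ tendsto_const])
    show "(\<lambda>n. exp (100 * real i ^ 3) * (alternating n \<bullet> e 0)) \<longlonglongrightarrow> 0"
      using tendsto_mult_right_zero[OF alternating_height_tendsto_0] by blast
  qed (use hundal_cone_coord[OF alternating_in_cone] in auto)
  then have "(\<lambda>n. horiz (alternating n) \<bullet> e i) \<longlonglongrightarrow> 0"
    by (cases "i = 0") (simp_all add: inner_horiz_basis)
  then show "(\<lambda>n. horiz (alternating (Suc n)) \<bullet> e i) \<longlonglongrightarrow> 0" by (rule LIMSEQ_Suc)
qed

lemma horiz_alternating_not_tendsto_0: "\<not> (\<lambda>n. horiz (alternating (Suc n))) \<longlonglongrightarrow> 0"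
proof
  assume "(\<lambda>n. horiz (alternating (Suc n))) \<longlonglongrightarrow> 0"
  then have "(\<lambda>n. norm (horiz (alternating (Suc n)))) \<longlonglongrightarrow> 0" by (rule tendsto_norm_zero)
  then have "1 / 20 \<le> (0::real)"
    by (rule LIMSEQ_le_const) (use norm_horiz_alternating_ge in blast)
  then show False by simp
qed

text \<open>Compositions of firmly nonexpansive maps need not be firmly nonexpansive; here it works
  because \<open>horiz\<close> is linear, self-adjoint and norm-nonincreasing and appears on both
  sides.\<close>

lemma sandwich_firmly_nonexpansive:
  "(norm (horiz (proj hundal_cone (horiz u)) - horiz (proj hundal_cone (horiz v))))\<^sup>2
    \<le> (horiz (proj hundal_cone (horiz u)) - horiz (proj hundal_cone (horiz v))) \<bullet> (u - v)"
proof -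
  let ?p = "proj hundal_cone (horiz u) - proj hundal_cone (horiz v)"
  have lin: "horiz a - horiz b = horiz (a - b)" for a b
    by (simp add: horiz_def inner_diff_left algebra_simps)
  have "(norm (horiz ?p))\<^sup>2 \<le> (norm ?p)\<^sup>2" using norm_eq_horiz[of ?p] by simp
  also have "\<dots> \<le> ?p \<bullet> (horiz u - horiz v)"
    by (rule proj_firmly_nonexpansive[OF hundal_cone_closed(1,2) hundal_cone_nonempty])
  also have "\<dots> = horiz ?p \<bullet> (u - v)"
    unfolding lin by (simp add: horiz_def inner_diff_left inner_diff_right inner_commute algebra_simps)
  finally show ?thesis by (simp add: lin)
qed

end

section \<open>The Douglas--Rachford iteration\<close>

theorem mainTheorem1:
  fixes e :: "nat \<Rightarrow> 'a::{real_inner, polish_space}"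
    and V K :: "'a set"
    and A B :: "'a operator"
  assumes "infinite_dimensional TYPE('a)"
    and "orthonormal_basis e"
    and V: "V = {e 0}\<^sup>\<bottom>"
    and K: "K = closed_convex_cone_hull
      {exp (- 100 * \<xi> ^ 3) *\<^sub>R e 0
        + cos (pi * (\<xi> - of_int \<lfloor>\<xi>\<rfloor>) / 2) *\<^sub>R e (nat \<lfloor>\<xi>\<rfloor> + 1)
        + sin (pi * (\<xi> - of_int \<lfloor>\<xi>\<rfloor>) / 2) *\<^sub>R e (nat \<lfloor>\<xi>\<rfloor> + 2) | \<xi>::real. \<xi> \<ge> 0}"
    and A: "A = (\<lambda>x. if x \<in> V then V\<^sup>\<bottom> else {})"
    and B: "B = op_diff (op_inverse (op_of_fun (proj V \<circ> proj K \<circ> proj V))) (op_of_fun id)"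
  shows "maximally_monotone A \<and> maximally_monotone B \<and>
    (\<forall>x y :: nat \<Rightarrow> 'a.
      y 0 = e 2 \<longrightarrow>
      (\<forall>n. x n = resolvent_map B (y n)) \<longrightarrow>
      (\<forall>n. y (Suc n) = y n + resolvent_map A (2 *\<^sub>R x n - y n) - x n) \<longrightarrow>
      (\<exists>z. 0 \<in> op_add A B z \<and> weakly_converges x z \<and> \<not> x \<longlonglongrightarrow> z))"
proof -
  interpret total_orthonormal e
    by unfold_locales (fact \<open>orthonormal_basis e\<close>)
  have V_eq: "V = hyperplane" by (simp add: V hyperplane_def)
  have K_eq: "K = hundal_cone"
    unfolding K hundal_cone_def spiral_def direction_def by (simp only: add.assoc)
  define T where "T u = horiz (proj hundal_cone (horiz u))" for u
  have "proj V \<circ> proj K \<circ> proj V = T"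
    by (auto simp: V_eq K_eq proj_hyperplane T_def)
  then have B_eq: "B = op_diff (op_inverse (op_of_fun T)) (op_of_fun id)" by (simp add: B)
  have A_eq: "A = (\<lambda>x. if x \<in> hyperplane then hyperplane\<^sup>\<bottom> else {})" unfolding A V_eq ..
  have maxA: "maximally_monotone A"
    unfolding A_eq by (rule maximally_monotone_normal_cone[OF subspace_hyperplane hyperplane_split])
  have maxB: "maximally_monotone B"
    unfolding B_eq
    by (rule maximally_monotone_firmly_nonexpansive) (simp add: T_def sandwich_firmly_nonexpansive)
  have "\<exists>z. 0 \<in> op_add A B z \<and> weakly_converges x z \<and> \<not> x \<longlonglongrightarrow> z"
    if y0: "y 0 = e 2" and x: "\<forall>n. x n = resolvent_map B (y n)"
      and y: "\<forall>n. y (Suc n) = y n + resolvent_map A (2 *\<^sub>R x n - y n) - x n" for x y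
  proof -
    have x_eq: "x n = T (y n)" for n
      using x by (simp add: B_eq resolvent_map_op_inverse_diff_id)
    have T_V: "T u \<in> hyperplane" for u by (simp add: T_def horiz_in_hyperplane)
    have horiz_id: "horiz u = u" if "u \<in> hyperplane" for u
      using that by (simp add: horiz_def mem_hyperplane)
    \<comment> \<open>On \<open>V\<close> the resolvent of \<open>A\<close> fixes the reflected
      point \<open>2 *\<^sub>R x n - y n\<close>, so the update collapses to
      \<open>x n\<close>.\<close>
    have y_Suc: "y (Suc n) = x n" if "y n \<in> hyperplane" for n
    proof -
      have "2 *\<^sub>R x n - y n \<in> hyperplane"
        using that T_V x_eq by (auto intro!: subspace_diff subspace_scale subspace_hyperplane)
      then have "resolvent_map A (2 *\<^sub>R x n - y n) = 2 *\<^sub>R x n - y n"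
        unfolding A_eq by (rule resolvent_map_normal_cone[OF subspace_hyperplane])
      then show ?thesis using y by (simp add: scaleR_2)
    qed
    have y_eq: "y n = horiz (alternating n)" for n
    proof (induction n)
      case 0
      have "direction 1 = e 2"
        using direction_cell[of 1 1] by (simp add: numeral_2_eq_2)
      then show ?case by (simp add: y0 alternating_0 horiz_spiral)
    next
      case (Suc n)
      then have "y n \<in> hyperplane" by (simp add: horiz_in_hyperplane)
      then show ?case
        using Suc by (simp add: y_Suc x_eq T_def horiz_id alternating_Suc)
    qed
    have "x = (\<lambda>n. horiz (alternating (Suc n)))"
      using y_eq y_Suc horiz_in_hyperplane by metis
    moreover have "0 \<in> op_add A B 0"
    proof -
      have "0 \<in> hundal_cone"
        using hundal_cone_closed(3) hundal_cone_nonempty cone_0 by (metis cone_contains_0)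
      then have "proj hundal_cone 0 = 0" by (rule proj_eqI) simp
      then have "T 0 = 0" by (simp add: T_def horiz_def)
      then have "0 \<in> B 0" by (simp add: B_eq mem_op_inverse_diff_id)
      moreover have "0 \<in> A 0"
        by (simp add: A_eq subspace_0 subspace_hyperplane subspace_orthogonal_comp)
      ultimately show ?thesis unfolding op_add_def by force
    qed
    ultimately show ?thesis
      using horiz_alternating_weakly_converges horiz_alternating_not_tendsto_0 by blast
  qed
  then show ?thesis using maxA maxB by blast
qed

end
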